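(* Up to isomorphism there are exactly four 2-qBMGs on the vertex set $\{v_1,v_2,v_3,v_4\}$ whose underlying undirected graph is a $P_4$ path graph, namely those with edge sets $\{v_1v_2,v_1v_4,v_2v_3\}$, $\{v_1v_2,v_1v_4,v_3v_4\}$, $\{v_1v_2,v_1v_4,v_2v_1,v_2v_3\}$, $\{v_1v_2,v_2v_1,v_4v_1,v_4v_3\}$ (where $xy$ denotes the directed edge from $x$ to $y$).
   Context: A two-color quasi best match graph (2-qBMG) is a bipartite directed graph $\overrightarrow{G}$ (vertex set split into two color classes, every edge joining vertices of different colors) without loops and parallel edges, satisfying: (N1) if $u$ and $v$ are two independent (non-adjacent) vertices then there exist no vertices $w,t$ such that $ut, vw, tw$ are edges; (N2) if $uv, vw, wt$ are edges then $ut$ is an edge; (N3) if $u$ and $v$ have a common out-neighbor then either every out-neighbor of $u$ is an out-neighbor of $v$ or every out-neighbor of $v$ is an out-neighbor of $u$. The underlying undirected graph of a digraph has the same vertex set and an undirected edge $\{u,v\}$ whenever $uv$ or $vu$ is a directed edge. A $P_4$ path graph is a graph on four vertices isomorphic to the path with three edges and no other edges. Two digraphs on the same vertex set $V$ are isomorphic if some permutation $\varphi$ of $V$ satisfies: $xy$ is an edge of the first iff $\varphi(x)\varphi(y)$ is an edge of the second. *)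

theory Defs
  imports "Graph_Theory.Pair_Digraph" "HOL-Combinatorics.Permutations"
begin

text \<open>
  A \<open>pair_digraph\<close> is finite and loop-free, and its arcs are ordered pairs, so there are no
  parallel edges, while a pair of opposite edges \<open>uv\<close>, \<open>vu\<close> is allowed.
\<close>

locale two_qBMG = pair_digraph G for G :: "'a pair_pre_digraph" +
  assumes bipartite:
    "\<exists>A B. A \<union> B = pverts G \<and> A \<inter> B = {} \<and>
      (\<forall>(x, y) \<in> parcs G. (x \<in> A \<and> y \<in> B) \<or> (x \<in> B \<and> y \<in> A))"
  and N1:
    "\<lbrakk>u \<in> pverts G; v \<in> pverts G; u \<noteq> v; (u, v) \<notin> parcs G; (v, u) \<notin> parcs G\<rbrakk> \<Longrightarrow>
      \<not> (\<exists>w t. (u, t) \<in> parcs G \<and> (v, w) \<in> parcs G \<and> (t, w) \<in> parcs G)"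
  and N2:
    "\<lbrakk>(u, v) \<in> parcs G; (v, w) \<in> parcs G; (w, t) \<in> parcs G\<rbrakk> \<Longrightarrow> (u, t) \<in> parcs G"
  and N3:
    "\<lbrakk>(u, x) \<in> parcs G; (v, x) \<in> parcs G\<rbrakk> \<Longrightarrow>
      (\<forall>y. (u, y) \<in> parcs G \<longrightarrow> (v, y) \<in> parcs G) \<or>
      (\<forall>y. (v, y) \<in> parcs G \<longrightarrow> (u, y) \<in> parcs G)"

definition digraph_isomorphic :: "'a pair_pre_digraph \<Rightarrow> 'a pair_pre_digraph \<Rightarrow> bool" where
  "digraph_isomorphic G H \<longleftrightarrow> pverts G = pverts H \<and>
    (\<exists>\<phi>. \<phi> permutes pverts G \<and>
      (\<forall>x \<in> pverts G. \<forall>y \<in> pverts G. (x, y) \<in> parcs G \<longleftrightarrow> (\<phi> x, \<phi> y) \<in> parcs H))"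

text \<open>An undirected simple graph is a vertex set together with a set of two-element edges.\<close>

type_synonym 'a ugraph = "'a set \<times> 'a set set"

definition underlying_ugraph :: "'a pair_pre_digraph \<Rightarrow> 'a ugraph" where
  "underlying_ugraph G = (pverts G, {{u, v} | u v. (u, v) \<in> parcs G \<or> (v, u) \<in> parcs G})"

definition ugraph_isomorphic :: "'a ugraph \<Rightarrow> 'b ugraph \<Rightarrow> bool" where
  "ugraph_isomorphic X Y \<longleftrightarrow>
    (\<exists>f. bij_betw f (fst X) (fst Y) \<and>
      (\<forall>x \<in> fst X. \<forall>y \<in> fst X. {x, y} \<in> snd X \<longleftrightarrow> {f x, f y} \<in> snd Y))"

text \<open>The path with \<open>n\<close> vertices.\<close>

definition path_ugraph :: "nat \<Rightarrow> nat ugraph" where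
  "path_ugraph n = ({..<n}, {{i, Suc i} | i. Suc i < n})"

definition P4_two_qBMGs :: "'a set \<Rightarrow> 'a pair_pre_digraph set" where
  "P4_two_qBMGs V =
    {G. pverts G = V \<and> two_qBMG G \<and> ugraph_isomorphic (underlying_ugraph G) (path_ugraph 4)}"

end

theory Submission
  imports Defs
begin

text \<open>
  Orient the path \<open>a - b - c - d\<close>. Since the endpoints are not adjacent, (N1) says exactly that
  \<open>ab\<close> and \<open>dc\<close> are not both edges, (N2) excludes the two directed paths along the
  whole of \<open>P\<^sub>4\<close>, and (N3) holds automatically. Of the 27 orientations 7 survive; reversing the
  path groups them into four classes, which are told apart by the presence of a 2-cycle and of two
  vertices with a common out-neighbour.
\<close>

section \<open>Counting equivalence classes by representatives\<close>

text \<open>Mapping an index to the class of its representative is onto the quotient because every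
  element is related to some \<open>x i\<close>, and injective because equal classes would relate
  two different representatives.\<close>

lemma card_quotient_representatives:
  assumes "equiv A R" and "\<And>i. i < n \<Longrightarrow> x i \<in> A"
    and "\<And>i j. i < n \<Longrightarrow> j < n \<Longrightarrow> i \<noteq> j \<Longrightarrow> (x i, x j) \<notin> R"
    and "\<And>a. a \<in> A \<Longrightarrow> \<exists>i<n. (a, x i) \<in> R"
  shows "card (A // R) = n"
proof -
  have "A // R = (\<lambda>i. R `` {x i}) ` {..<n}"
  proof
    show "A // R \<subseteq> (\<lambda>i. R `` {x i}) ` {..<n}"
    proof
      fix X assume "X \<in> A // R"
      then obtain a where a: "a \<in> A" "X = R `` {a}" by (auto elim: quotientE)
      with assms(4) obtain i where "i < n" "(a, x i) \<in> R" by blast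
      then show "X \<in> (\<lambda>i. R `` {x i}) ` {..<n}"
        using a equiv_class_eq[OF assms(1)] by auto
    qed
  qed (auto intro: quotientI assms(2))
  moreover have "inj_on (\<lambda>i. R `` {x i}) {..<n}"
  proof (rule inj_onI)
    fix i j assume ij: "i \<in> {..<n}" "j \<in> {..<n}" "R `` {x i} = R `` {x j}"
    then have "(x i, x j) \<in> R"
      using eq_equiv_class[OF ij(3) assms(1)] assms(2) by auto
    then show "i = j" using assms(3) ij by auto
  qed
  ultimately show ?thesis by (simp add: card_image)
qed

section \<open>Digraph isomorphism as an equivalence relation\<close>

lemma digraph_isomorphicE:
  assumes "digraph_isomorphic G H"
  obtains \<phi> where "pverts G = pverts H" "\<phi> permutes pverts G"
    "\<And>x y. x \<in> pverts G \<Longrightarrow> y \<in> pverts G \<Longrightarrow> (x, y) \<in> parcs G \<longleftrightarrow> (\<phi> x, \<phi> y) \<in> parcs H"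
  using assms unfolding digraph_isomorphic_def by blast

lemma digraph_isomorphicI:
  assumes "pverts G = pverts H" "\<phi> permutes pverts G"
    "\<And>x y. x \<in> pverts G \<Longrightarrow> y \<in> pverts G \<Longrightarrow> (x, y) \<in> parcs G \<longleftrightarrow> (\<phi> x, \<phi> y) \<in> parcs H"
  shows "digraph_isomorphic G H"
  using assms unfolding digraph_isomorphic_def by blast

lemma digraph_isomorphic_refl: "digraph_isomorphic G G"
  by (rule digraph_isomorphicI[where \<phi> = id]) (simp_all add: permutes_id)

lemma digraph_isomorphic_sym:
  assumes "digraph_isomorphic G H"
  shows "digraph_isomorphic H G"
  using assms
proof (rule digraph_isomorphicE)
  fix \<phi>
  assume V: "pverts G = pverts H" and \<phi>: "\<phi> permutes pverts G"
    and arcs: "\<And>x y. x \<in> pverts G \<Longrightarrow> y \<in> pverts G \<Longrightarrow>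
      (x, y) \<in> parcs G \<longleftrightarrow> (\<phi> x, \<phi> y) \<in> parcs H"
  show "digraph_isomorphic H G"
  proof (rule digraph_isomorphicI)
    show "inv \<phi> permutes pverts H" using permutes_inv[OF \<phi>] V by simp
    fix x y assume "x \<in> pverts H" "y \<in> pverts H"
    then have "inv \<phi> x \<in> pverts G" "inv \<phi> y \<in> pverts G"
      using permutes_in_image[OF permutes_inv[OF \<phi>]] V by simp_all
    then show "(x, y) \<in> parcs H \<longleftrightarrow> (inv \<phi> x, inv \<phi> y) \<in> parcs G"
      using arcs permutes_inverses(1)[OF \<phi>] by simp
  qed (simp add: V)
qed

lemma digraph_isomorphic_trans:
  assumes "digraph_isomorphic G H" and "digraph_isomorphic H K"
  shows "digraph_isomorphic G K"
proof -
  obtain \<phi> where V: "pverts G = pverts H" and \<phi>: "\<phi> permutes pverts G"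
    and GH: "\<And>x y. x \<in> pverts G \<Longrightarrow> y \<in> pverts G \<Longrightarrow>
      (x, y) \<in> parcs G \<longleftrightarrow> (\<phi> x, \<phi> y) \<in> parcs H"
    using assms(1) by (rule digraph_isomorphicE) blast
  obtain \<psi> where V': "pverts H = pverts K" and \<psi>: "\<psi> permutes pverts H"
    and HK: "\<And>x y. x \<in> pverts H \<Longrightarrow> y \<in> pverts H \<Longrightarrow>
      (x, y) \<in> parcs H \<longleftrightarrow> (\<psi> x, \<psi> y) \<in> parcs K"
    using assms(2) by (rule digraph_isomorphicE) blast
  show ?thesis
  proof (rule digraph_isomorphicI)
    show "\<psi> \<circ> \<phi> permutes pverts G" using \<phi> \<psi> V by (simp add: permutes_compose)
    fix x y assume xy: "x \<in> pverts G" "y \<in> pverts G"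
    then have "\<phi> x \<in> pverts H" "\<phi> y \<in> pverts H" using permutes_in_image[OF \<phi>] V by simp_all
    then show "(x, y) \<in> parcs G \<longleftrightarrow> ((\<psi> \<circ> \<phi>) x, (\<psi> \<circ> \<phi>) y) \<in> parcs K"
      using GH[OF xy] HK by simp
  qed (simp add: V V')
qed

section \<open>Relabelling four distinct points\<close>

text \<open>Having both orders of each inequality as rewrite rules lets simplification settle every
  comparison of two named vertices.\<close>

lemma distinct_fourD:
  assumes "distinct [a, b, c, d]"
  shows "a \<noteq> b" "b \<noteq> a" "a \<noteq> c" "c \<noteq> a" "a \<noteq> d" "d \<noteq> a"
    "b \<noteq> c" "c \<noteq> b" "b \<noteq> d" "d \<noteq> b" "c \<noteq> d" "d \<noteq> c"
  using assms by auto

lemma permutes_four_points: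
  assumes "distinct [a, b, c, d]" "distinct [a', b', c', d']" "{a, b, c, d} = {a', b', c', d'}"
  obtains \<phi> where "\<phi> permutes {a, b, c, d}" "\<phi> a = a'" "\<phi> b = b'" "\<phi> c = c'" "\<phi> d = d'"
proof -
  \<comment> \<open>Off the four points \<open>\<phi>\<close> is the identity, as
    \<open>permutes\<close> demands.\<close>
  define \<phi> where
    "\<phi> x = (if x = a then a' else if x = b then b' else if x = c then c' else if x = d then d' else x)"
    for x
  have vals: "\<phi> a = a'" "\<phi> b = b'" "\<phi> c = c'" "\<phi> d = d'"
    using assms(1) by (auto simp: \<phi>_def)
  have "bij_betw \<phi> {a, b, c, d} {a, b, c, d}"
    unfolding bij_betw_def
  proof
    show "inj_on \<phi> {a, b, c, d}" using assms(2) vals by (auto simp: inj_on_def)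
    show "\<phi> ` {a, b, c, d} = {a, b, c, d}" unfolding assms(3) using vals assms(3)
      by (metis image_empty image_insert)
  qed
  then have "\<phi> permutes {a, b, c, d}"
    by (rule bij_imp_permutes) (auto simp: \<phi>_def)
  with vals that show thesis by blast
qed

text \<open>
  The underlying path is \<open>d - a - b - c\<close> in the first and third case and \<open>b - a - d - c\<close> in the
  other two.
\<close>

definition qBMG_arcs :: "'a \<Rightarrow> 'a \<Rightarrow> 'a \<Rightarrow> 'a \<Rightarrow> ('a \<times> 'a) set list" where
  "qBMG_arcs a b c d =
    [{(a, b), (a, d), (b, c)},
     {(a, b), (a, d), (c, d)},
     {(a, b), (a, d), (b, a), (b, c)},
     {(a, b), (b, a), (d, a), (d, c)}]"

section \<open>Four-vertex paths as underlying graphs\<close>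

lemma less_four: "i < 4 \<longleftrightarrow> i = 0 \<or> i = 1 \<or> i = 2 \<or> i = (3::nat)"
  by auto

lemma mem_underlying_ugraph:
  "{x, y} \<in> snd (underlying_ugraph G) \<longleftrightarrow> (x, y) \<in> parcs G \<or> (y, x) \<in> parcs G"
  unfolding underlying_ugraph_def by (auto simp: doubleton_eq_iff)

lemma mem_path_ugraph:
  "{i, j} \<in> snd (path_ugraph n) \<longleftrightarrow> i < n \<and> j < n \<and> (j = Suc i \<or> i = Suc j)"
  unfolding path_ugraph_def by (auto simp: doubleton_eq_iff)

text \<open>The isomorphism sends each vertex to its position along
  \<open>a - b - c - d\<close>.\<close>

lemma underlying_ugraph_pathI:
  assumes "distinct [a, b, c, d]" "pverts G = {a, b, c, d}"
    and "\<And>x y. (x, y) \<in> parcs G \<or> (y, x) \<in> parcs G \<longleftrightarrow>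
      (x, y) \<in> {(a, b), (b, a), (b, c), (c, b), (c, d), (d, c)}"
  shows "ugraph_isomorphic (underlying_ugraph G) (path_ugraph 4)"
proof -
  \<comment> \<open>The default value 3 serves \<open>d\<close>; only the values on the vertex set
    matter.\<close>
  define f where "f x = (if x = a then 0 else if x = b then 1 else if x = c then 2 else (3::nat))" for x
  have vals: "f a = 0" "f b = 1" "f c = 2" "f d = 3"
    using assms(1) by (auto simp: f_def)
  have "bij_betw f (fst (underlying_ugraph G)) (fst (path_ugraph 4))"
    using vals unfolding bij_betw_def inj_on_def underlying_ugraph_def path_ugraph_def
    by (auto simp: assms(2) less_four)
  moreover have "{x, y} \<in> snd (underlying_ugraph G) \<longleftrightarrow> {f x, f y} \<in> snd (path_ugraph 4)"
    if "x \<in> fst (underlying_ugraph G)" "y \<in> fst (underlying_ugraph G)" for x y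
  proof -
    have "x \<in> {a, b, c, d}" "y \<in> {a, b, c, d}"
      using that by (simp_all add: underlying_ugraph_def assms(2))
    then show ?thesis unfolding mem_underlying_ugraph assms(3) mem_path_ugraph insert_iff
      using vals by (elim disjE emptyE) (simp_all add: distinct_fourD[OF assms(1)])
  qed
  ultimately show ?thesis unfolding ugraph_isomorphic_def by blast
qed

text \<open>Inverting the isomorphism lists the vertices in path order, and adjacency becomes being
  consecutive in that list.\<close>

lemma underlying_ugraph_pathE:
  assumes "ugraph_isomorphic (underlying_ugraph G) (path_ugraph 4)"
  obtains a b c d where "distinct [a, b, c, d]" "pverts G = {a, b, c, d}"
    "\<forall>x \<in> pverts G. \<forall>y \<in> pverts G. (x, y) \<in> parcs G \<or> (y, x) \<in> parcs G \<longleftrightarrow>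
      (x, y) \<in> {(a, b), (b, a), (b, c), (c, b), (c, d), (d, c)}"
proof -
  obtain f where f: "bij_betw f (pverts G) {..<4::nat}"
    and edges: "\<And>x y. x \<in> pverts G \<Longrightarrow> y \<in> pverts G \<Longrightarrow>
      (x, y) \<in> parcs G \<or> (y, x) \<in> parcs G \<longleftrightarrow> {f x, f y} \<in> snd (path_ugraph 4)"
    using assms unfolding ugraph_isomorphic_def mem_underlying_ugraph
    by (auto simp: underlying_ugraph_def path_ugraph_def)
  \<comment> \<open>\<open>p i\<close> is the vertex at position \<open>i\<close> of the
    path.\<close>
  define p where "p = the_inv_into (pverts G) f"
  have p: "bij_betw p {..<4} (pverts G)"
    unfolding p_def using f by (rule bij_betw_the_inv_into)
  have fp: "f (p i) = i" if "i < 4" for i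
    using that f unfolding p_def by (auto intro: f_the_inv_into_f_bij_betw)
  have four: "{..<4::nat} = {0, 1, 2, 3}" by auto
  have V: "pverts G = {p 0, p 1, p 2, p 3}"
    using bij_betw_imp_surj_on[OF p] unfolding four by simp
  have dist: "distinct [p 0, p 1, p 2, p 3]"
    using bij_betw_imp_inj_on[OF p] unfolding four by (simp add: inj_on_def)
  have "(x, y) \<in> parcs G \<or> (y, x) \<in> parcs G \<longleftrightarrow>
      (x, y) \<in> {(p 0, p 1), (p 1, p 0), (p 1, p 2), (p 2, p 1), (p 2, p 3), (p 3, p 2)}"
    if xy: "x \<in> pverts G" "y \<in> pverts G" for x y
  proof -
    obtain i j where "i < 4" "j < 4" "x = p i" "y = p j"
      using xy bij_betw_imp_surj_on[OF p] by (metis imageE lessThan_iff)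
    then show ?thesis
      using fp unfolding edges[OF xy] mem_path_ugraph less_four
      by (elim disjE) (simp_all add: distinct_fourD[OF dist, simplified])
  qed
  with V dist that show thesis by blast
qed

section \<open>The listed digraphs satisfy the axioms\<close>

lemma qBMG_arcs_P4_two_qBMGs:
  assumes "distinct [a, b, c, d]" "i < 4"
  shows "\<lparr>pverts = {a, b, c, d}, parcs = qBMG_arcs a b c d ! i\<rparr> \<in> P4_two_qBMGs {a, b, c, d}"
    (is "?G \<in> _")
proof -
  \<comment> \<open>Knowing the arc set only as one of four explicit sets turns each axiom into a
    finite check on at most four arcs.\<close>
  define A where "A = qBMG_arcs a b c d ! i"
  have A: "A \<in> {{(a, b), (a, d), (b, c)}, {(a, b), (a, d), (c, d)},
      {(a, b), (a, d), (b, a), (b, c)}, {(a, b), (b, a), (d, a), (d, c)}}"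
    using assms(2) unfolding less_four A_def by (elim disjE) (simp_all add: qBMG_arcs_def)
  note neq = distinct_fourD[OF assms(1)]
  have "two_qBMG ?G"
  proof (unfold_locales, unfold A_def[symmetric] pair_pre_digraph.simps)
    have wf: "x \<in> {a, b, c, d} \<and> y \<in> {a, b, c, d} \<and> x \<noteq> y" if "(x, y) \<in> A" for x y
      using A that by (elim insertE emptyE) (auto simp: neq)
    show "fst e \<in> {a, b, c, d}" "snd e \<in> {a, b, c, d}" "fst e \<noteq> snd e" if "e \<in> A" for e
      using wf[of "fst e" "snd e"] that by simp_all
    show "finite {a, b, c, d}" by simp
    show "finite A" using A by (elim insertE emptyE) simp_all
    show "\<exists>B C. B \<union> C = {a, b, c, d} \<and> B \<inter> C = {} \<and>
      (\<forall>(x, y) \<in> A. (x \<in> B \<and> y \<in> C) \<or> (x \<in> C \<and> y \<in> B))"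
    proof (intro exI conjI)
      \<comment> \<open>One bipartition fits all indices: both underlying paths,
        \<open>d - a - b - c\<close> and \<open>b - a - d - c\<close>, alternate between these
        classes.\<close>
      show "{a, c} \<union> {b, d} = {a, b, c, d}" "{a, c} \<inter> {b, d} = {}"
        using neq by auto
      show "\<forall>(x, y) \<in> A. (x \<in> {a, c} \<and> y \<in> {b, d}) \<or> (x \<in> {b, d} \<and> y \<in> {a, c})"
        using A by (elim insertE emptyE) simp_all
    qed
  next
    fix u v assume "u \<noteq> v" "(u, v) \<notin> A" "(v, u) \<notin> A"
    \<comment> \<open>(N1) in contrapositive form: its premises are now arcs, which can be
      enumerated.\<close>
    moreover have "u = v \<or> (u, v) \<in> A \<or> (v, u) \<in> A"
      if "(u, t) \<in> A" "(v, w) \<in> A" "(t, w) \<in> A" for t w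
      using A that by (elim insertE emptyE) (auto simp: neq)
    ultimately show "\<not> (\<exists>w t. (u, t) \<in> A \<and> (v, w) \<in> A \<and> (t, w) \<in> A)" by blast
  next
    fix u v w t assume "(u, v) \<in> A" "(v, w) \<in> A" "(w, t) \<in> A"
    with A show "(u, t) \<in> A" by (elim insertE emptyE) (auto simp: neq)
  next
    fix u x v assume "(u, x) \<in> A" "(v, x) \<in> A"
    with A show "(\<forall>y. (u, y) \<in> A \<longrightarrow> (v, y) \<in> A) \<or> (\<forall>y. (v, y) \<in> A \<longrightarrow> (u, y) \<in> A)"
      by (elim insertE emptyE) (auto simp: neq)
  qed
  moreover have "ugraph_isomorphic (underlying_ugraph ?G) (path_ugraph 4)"
  proof (cases "i = 0 \<or> i = 2")
    case True
    show ?thesis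
    proof (rule underlying_ugraph_pathI)
      show "distinct [d, a, b, c]" by (simp add: distinct_fourD[OF assms(1)])
      show "pverts ?G = {d, a, b, c}" by auto
      show "(x, y) \<in> parcs ?G \<or> (y, x) \<in> parcs ?G \<longleftrightarrow>
          (x, y) \<in> {(d, a), (a, d), (a, b), (b, a), (b, c), (c, b)}" for x y
        using True by (elim disjE; auto simp: qBMG_arcs_def)
    qed
  next
    case False
    then have "i = 1 \<or> i = 3" using assms(2) by auto
    show ?thesis
    proof (rule underlying_ugraph_pathI)
      show "distinct [b, a, d, c]" by (simp add: distinct_fourD[OF assms(1)])
      show "pverts ?G = {b, a, d, c}" by auto
      show "(x, y) \<in> parcs ?G \<or> (y, x) \<in> parcs ?G \<longleftrightarrow>
          (x, y) \<in> {(b, a), (a, b), (a, d), (d, a), (d, c), (c, d)}" for x y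
        using \<open>i = 1 \<or> i = 3\<close> by (elim disjE; auto simp: qBMG_arcs_def)
    qed
  qed
  ultimately show ?thesis by (simp add: P4_two_qBMGs_def)
qed

section \<open>Classification of the orientations\<close>

text \<open>Propositional core of the classification; the last three assumptions are the
  consequences of (N1) and (N2). The tuples are grouped by isomorphism class, of sizes 2, 2, 1 and
  2. In a class of size 2 the entries are mirror images along the path, while the fifth tuple is its
  own mirror image.\<close>

lemma path_orientations:
  assumes "ab \<or> ba" "bc \<or> cb" "cd \<or> dc" "\<not> ab \<or> \<not> dc" "\<not> (ab \<and> bc \<and> cd)" "\<not> (dc \<and> cb \<and> ba)"
  shows "(ab, ba, bc, cb, cd, dc) \<in>
    {(False, True, True, False, True, False),
     (False, True, False, True, True, False),
     (False, True, True, False, False, True),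
     (True, False, False, True, True, False),
     (False, True, True, True, True, False),
     (True, True, False, True, True, False),
     (False, True, True, False, True, True)}"
  using assms by (cases ab; cases ba; cases bc; cases cb; cases cd; cases dc; simp)

text \<open>The path order of the vertices differs from the order in which \<open>qBMG_arcs\<close>
  takes its arguments, so the labels returned are a rearrangement of the path order.\<close>

lemma P4_two_qBMGs_cases:
  assumes "G \<in> P4_two_qBMGs V"
  obtains a b c d i where "distinct [a, b, c, d]" "V = {a, b, c, d}" "i < 4"
    "G = \<lparr>pverts = V, parcs = qBMG_arcs a b c d ! i\<rparr>"
proof -
  interpret two_qBMG G using assms by (simp add: P4_two_qBMGs_def)
  have V: "pverts G = V" and path: "ugraph_isomorphic (underlying_ugraph G) (path_ugraph 4)"
    using assms by (simp_all add: P4_two_qBMGs_def)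
  obtain a b c d where dist: "distinct [a, b, c, d]" and verts: "pverts G = {a, b, c, d}"
    and adj: "\<forall>x \<in> pverts G. \<forall>y \<in> pverts G. (x, y) \<in> parcs G \<or> (y, x) \<in> parcs G \<longleftrightarrow>
      (x, y) \<in> {(a, b), (b, a), (b, c), (c, b), (c, d), (d, c)}"
    by (rule underlying_ugraph_pathE[OF path])
  note adj = adj[rule_format]
  note neq = distinct_fourD[OF dist]
  have ad: "(a, d) \<notin> parcs G" "(d, a) \<notin> parcs G"
    using adj[of a d] by (simp_all add: verts neq)
  have ab: "(a, b) \<in> parcs G \<or> (b, a) \<in> parcs G"
    and bc: "(b, c) \<in> parcs G \<or> (c, b) \<in> parcs G"
    and cd: "(c, d) \<in> parcs G \<or> (d, c) \<in> parcs G"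
    using adj[of a b] adj[of b c] adj[of c d] by (simp_all add: verts)
  \<comment> \<open>The middle edge supplies the arc between the two heads. For \<open>bc\<close>
    take (N1) with \<open>u = a\<close>, \<open>t = b\<close>, \<open>v = d\<close>,
    \<open>w = c\<close>; for \<open>cb\<close> exchange the two ends of the path.\<close>
  have inward: "(a, b) \<notin> parcs G \<or> (d, c) \<notin> parcs G"
  proof -
    have "\<not> (\<exists>w t. (a, t) \<in> parcs G \<and> (d, w) \<in> parcs G \<and> (t, w) \<in> parcs G)"
      and "\<not> (\<exists>w t. (d, t) \<in> parcs G \<and> (a, w) \<in> parcs G \<and> (t, w) \<in> parcs G)"
      by (rule N1; simp add: verts ad neq)+
    with bc show ?thesis by blast
  qed
  \<comment> \<open>Otherwise (N2) would join the two endpoints by an arc, contrary to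
    \<open>ad\<close>.\<close>
  have right: "\<not> ((a, b) \<in> parcs G \<and> (b, c) \<in> parcs G \<and> (c, d) \<in> parcs G)"
    and left: "\<not> ((d, c) \<in> parcs G \<and> (c, b) \<in> parcs G \<and> (b, a) \<in> parcs G)"
    using N2[of a b c d] N2[of d c b a] ad by blast+
  have sub: "parcs G \<subseteq> {(a, b), (b, a), (b, c), (c, b), (c, d), (d, c)}"
  proof (rule subrelI)
    fix x y assume xy: "(x, y) \<in> parcs G"
    then show "(x, y) \<in> {(a, b), (b, a), (b, c), (c, b), (c, d), (d, c)}"
      using adj[OF in_arcsD1[OF xy] in_arcsD2[OF xy]] by simp
  qed
  \<comment> \<open>As only six arcs are possible, the truth values recorded in a direction tuple
    determine the arc set.\<close>
  have eqI: "parcs G = X"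
    if "X \<subseteq> parcs G" "\<forall>e \<in> {(a, b), (b, a), (b, c), (c, b), (c, d), (d, c)}. e \<notin> X \<longrightarrow> e \<notin> parcs G" for X
    using sub that by blast
  let ?dirs = "((a, b) \<in> parcs G, (b, a) \<in> parcs G, (b, c) \<in> parcs G, (c, b) \<in> parcs G,
    (c, d) \<in> parcs G, (d, c) \<in> parcs G)"
  \<comment> \<open>For indices 0 and 2 the underlying path visits the fourth, first, second and
    third argument, so matching it to \<open>a - b - c - d\<close> forwards or backwards gives
    \<open>b c d a\<close> or \<open>c b a d\<close>. For 1 and 3 the order is second, first,
    fourth, third, which gives \<open>b a d c\<close> or \<open>c d a b\<close>.\<close>
  from path_orientations[OF ab bc cd inward right left]
  have "\<exists>i<4. parcs G = qBMG_arcs b c d a ! i \<or> parcs G = qBMG_arcs c b a d ! i \<or>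
     parcs G = qBMG_arcs b a d c ! i \<or> parcs G = qBMG_arcs c d a b ! i"
  proof (elim insertE emptyE)
    assume "?dirs = (False, True, True, False, True, False)"
    then have "parcs G = {(b, c), (b, a), (c, d)}" by (intro eqI) simp_all
    then show ?thesis by (intro exI[of _ 0]) (simp add: qBMG_arcs_def)
  next
    assume "?dirs = (False, True, False, True, True, False)"
    then have "parcs G = {(c, b), (c, d), (b, a)}" by (intro eqI) simp_all
    then show ?thesis by (intro exI[of _ 0]) (simp add: qBMG_arcs_def)
  next
    assume "?dirs = (False, True, True, False, False, True)"
    then have "parcs G = {(b, a), (b, c), (d, c)}" by (intro eqI) simp_all
    then show ?thesis by (intro exI[of _ 1]) (simp add: qBMG_arcs_def)
  next
    assume "?dirs = (True, False, False, True, True, False)"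
    then have "parcs G = {(c, d), (c, b), (a, b)}" by (intro eqI) simp_all
    then show ?thesis by (intro exI[of _ 1]) (simp add: qBMG_arcs_def)
  next
    assume "?dirs = (False, True, True, True, True, False)"
    then have "parcs G = {(b, c), (b, a), (c, b), (c, d)}" by (intro eqI) simp_all
    then show ?thesis by (intro exI[of _ 2]) (simp add: qBMG_arcs_def)
  next
    assume "?dirs = (True, True, False, True, True, False)"
    then have "parcs G = {(b, a), (a, b), (c, b), (c, d)}" by (intro eqI) simp_all
    then show ?thesis by (intro exI[of _ 3]) (simp add: qBMG_arcs_def)
  next
    assume "?dirs = (False, True, True, False, True, True)"
    then have "parcs G = {(c, d), (d, c), (b, c), (b, a)}" by (intro eqI) simp_all
    then show ?thesis by (intro exI[of _ 3]) (simp add: qBMG_arcs_def)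
  qed
  then obtain i where i: "i < 4"
    and arcs: "parcs G = qBMG_arcs b c d a ! i \<or> parcs G = qBMG_arcs c b a d ! i \<or>
     parcs G = qBMG_arcs b a d c ! i \<or> parcs G = qBMG_arcs c d a b ! i"
    by blast
  have G: "G = \<lparr>pverts = V, parcs = X\<rparr>" if "parcs G = X" for X
    using that V by simp
  have perm: "V = {b, c, d, a}" "V = {c, b, a, d}" "V = {b, a, d, c}" "V = {c, d, a, b}"
    unfolding V[symmetric] verts by auto
  from arcs show thesis
  proof (elim disjE)
    assume "parcs G = qBMG_arcs b c d a ! i"
    then show thesis by (intro that[OF _ perm(1) i G]) (simp_all add: neq)
  next
    assume "parcs G = qBMG_arcs c b a d ! i"
    then show thesis by (intro that[OF _ perm(2) i G]) (simp_all add: neq)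
  next
    assume "parcs G = qBMG_arcs b a d c ! i"
    then show thesis by (intro that[OF _ perm(3) i G]) (simp_all add: neq)
  next
    assume "parcs G = qBMG_arcs c d a b ! i"
    then show thesis by (intro that[OF _ perm(4) i G]) (simp_all add: neq)
  qed
qed

section \<open>Isomorphisms and separating invariants\<close>

text \<open>The arc lists are uniform in the labels, so the permutation that renames the vertices
  carries each entry to the entry of the same index.\<close>

lemma qBMG_arcs_isomorphic:
  assumes "distinct [a, b, c, d]" "distinct [a', b', c', d']" "{a, b, c, d} = {a', b', c', d'}"
    and "i < 4"
  shows "digraph_isomorphic \<lparr>pverts = {a, b, c, d}, parcs = qBMG_arcs a b c d ! i\<rparr>
    \<lparr>pverts = {a, b, c, d}, parcs = qBMG_arcs a' b' c' d' ! i\<rparr>"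
proof -
  obtain \<phi> where \<phi>: "\<phi> permutes {a, b, c, d}"
    and vals: "\<phi> a = a'" "\<phi> b = b'" "\<phi> c = c'" "\<phi> d = d'"
    using permutes_four_points[OF assms(1-3)] .
  have arcs: "map_prod \<phi> \<phi> ` (qBMG_arcs a b c d ! i) = qBMG_arcs a' b' c' d' ! i"
    using assms(4) unfolding less_four by (elim disjE) (simp_all add: qBMG_arcs_def vals)
  \<comment> \<open>Injectivity on pairs upgrades the image equation to an equivalence: no non-arc
    is sent to an arc.\<close>
  have "inj (map_prod \<phi> \<phi>)"
    by (intro prod.inj_map permutes_inj[OF \<phi>])
  then have "e \<in> qBMG_arcs a b c d ! i \<longleftrightarrow> map_prod \<phi> \<phi> e \<in> qBMG_arcs a' b' c' d' ! i" for e
    unfolding arcs[symmetric] by (simp add: inj_image_mem_iff)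
  from this[of "(_, _)"] show ?thesis
    using \<phi> by (intro digraph_isomorphicI) simp_all
qed

text \<open>This invariant and the next quantify over vertices only, since an isomorphism compares
  arcs only between vertices; on an explicit vertex set they expand to finite disjunctions.\<close>

definition has_two_cycle :: "'a pair_pre_digraph \<Rightarrow> bool" where
  "has_two_cycle G \<longleftrightarrow>
    (\<exists>x \<in> pverts G. \<exists>y \<in> pverts G. (x, y) \<in> parcs G \<and> (y, x) \<in> parcs G)"

definition has_common_out_neighbour :: "'a pair_pre_digraph \<Rightarrow> bool" where
  "has_common_out_neighbour G \<longleftrightarrow>
    (\<exists>x \<in> pverts G. \<exists>y \<in> pverts G. \<exists>z \<in> pverts G. x \<noteq> y \<and> (x, z) \<in> parcs G \<and> (y, z) \<in> parcs G)"

lemma digraph_isomorphic_invariants: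
  assumes "digraph_isomorphic G H"
  shows "has_two_cycle G = has_two_cycle H"
    and "has_common_out_neighbour G = has_common_out_neighbour H"
proof -
  \<comment> \<open>Preservation in one direction for arbitrary digraphs suffices, because
    isomorphism is symmetric.\<close>
  have "(has_two_cycle G \<longrightarrow> has_two_cycle H) \<and>
    (has_common_out_neighbour G \<longrightarrow> has_common_out_neighbour H)"
    if "digraph_isomorphic G H" for G H :: "'a pair_pre_digraph"
  proof -
    obtain \<phi> where V: "pverts G = pverts H" and \<phi>: "\<phi> permutes pverts G"
      and arcs: "\<And>x y. x \<in> pverts G \<Longrightarrow> y \<in> pverts G \<Longrightarrow>
        (x, y) \<in> parcs G \<longleftrightarrow> (\<phi> x, \<phi> y) \<in> parcs H"
      using \<open>digraph_isomorphic G H\<close> by (rule digraph_isomorphicE) blast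
    have mem: "\<phi> x \<in> pverts H \<longleftrightarrow> x \<in> pverts G" for x
      using permutes_in_image[OF \<phi>] V by simp
    have inj: "\<phi> x = \<phi> y \<longleftrightarrow> x = y" for x y
      using permutes_inj[OF \<phi>] by (auto dest: injD)
    show ?thesis
      unfolding has_two_cycle_def has_common_out_neighbour_def using arcs mem inj by metis
  qed
  with assms digraph_isomorphic_sym show "has_two_cycle G = has_two_cycle H"
    and "has_common_out_neighbour G = has_common_out_neighbour H" by blast+
qed

text \<open>The two truth values are the binary digits of \<open>i\<close>, so together they
  determine the index. The 2-cycle joins \<open>a\<close> and \<open>b\<close>; the common
  out-neighbour is \<open>d\<close> for index 1 and \<open>a\<close> for index 3.\<close>

lemma qBMG_arcs_invariants:
  assumes "distinct [a, b, c, d]" "i < 4"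
  shows "has_two_cycle \<lparr>pverts = {a, b, c, d}, parcs = qBMG_arcs a b c d ! i\<rparr> \<longleftrightarrow> i \<in> {2, 3}"
    and "has_common_out_neighbour \<lparr>pverts = {a, b, c, d}, parcs = qBMG_arcs a b c d ! i\<rparr>
      \<longleftrightarrow> i \<in> {1, 3}"
  using assms(2) unfolding has_two_cycle_def has_common_out_neighbour_def less_four
  by (elim disjE; simp add: qBMG_arcs_def distinct_fourD[OF assms(1)])+

lemma qBMG_arcs_not_isomorphic:
  assumes "distinct [a, b, c, d]" "i < 4" "j < 4" "i \<noteq> j"
  shows "\<not> digraph_isomorphic \<lparr>pverts = {a, b, c, d}, parcs = qBMG_arcs a b c d ! i\<rparr>
    \<lparr>pverts = {a, b, c, d}, parcs = qBMG_arcs a b c d ! j\<rparr>" (is "\<not> digraph_isomorphic ?G ?H")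
proof
  assume "digraph_isomorphic ?G ?H"
  then have "(i \<in> {2, 3} \<longleftrightarrow> j \<in> {2, 3}) \<and> (i \<in> {1, 3} \<longleftrightarrow> j \<in> {1, 3})"
    using digraph_isomorphic_invariants qBMG_arcs_invariants[OF assms(1,2)]
      qBMG_arcs_invariants[OF assms(1,3)] by blast
  then show False using assms(2-4) by (auto simp: less_four)
qed

section \<open>Counting the isomorphism classes\<close>

theorem theorem3p5:
  fixes v1 v2 v3 v4 :: 'a
  assumes "distinct [v1, v2, v3, v4]"
  defines "V \<equiv> {v1, v2, v3, v4}"
  defines "Gs \<equiv>
    [\<lparr>pverts = V, parcs = {(v1, v2), (v1, v4), (v2, v3)}\<rparr>,
     \<lparr>pverts = V, parcs = {(v1, v2), (v1, v4), (v3, v4)}\<rparr>,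
     \<lparr>pverts = V, parcs = {(v1, v2), (v1, v4), (v2, v1), (v2, v3)}\<rparr>,
     \<lparr>pverts = V, parcs = {(v1, v2), (v2, v1), (v4, v1), (v4, v3)}\<rparr>]"
  defines "R \<equiv> {(G, H). G \<in> P4_two_qBMGs V \<and> H \<in> P4_two_qBMGs V \<and> digraph_isomorphic G H}"
  shows "card (P4_two_qBMGs V // R) = 4 \<and>
    (\<forall>i<4. Gs ! i \<in> P4_two_qBMGs V) \<and>
    (\<forall>i<4. \<forall>j<4. i \<noteq> j \<longrightarrow> \<not> digraph_isomorphic (Gs ! i) (Gs ! j)) \<and>
    (\<forall>G \<in> P4_two_qBMGs V. \<exists>i<4. digraph_isomorphic G (Gs ! i))"
proof -
  have Gs: "Gs ! i = \<lparr>pverts = V, parcs = qBMG_arcs v1 v2 v3 v4 ! i\<rparr>" if "i < 4" for i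
    using that unfolding less_four Gs_def qBMG_arcs_def by (elim disjE) simp_all
  have mem: "Gs ! i \<in> P4_two_qBMGs V" if "i < 4" for i
    using qBMG_arcs_P4_two_qBMGs[OF assms(1) that] Gs[OF that] by (simp add: V_def)
  have noniso: "\<not> digraph_isomorphic (Gs ! i) (Gs ! j)" if "i < 4" "j < 4" "i \<noteq> j" for i j
    using qBMG_arcs_not_isomorphic[OF assms(1) that] Gs that by (simp add: V_def)
  have iso: "\<exists>i<4. digraph_isomorphic G (Gs ! i)" if G: "G \<in> P4_two_qBMGs V" for G
  proof -
    obtain a b c d i where abcd: "distinct [a, b, c, d]" "V = {a, b, c, d}" and i: "i < 4"
      and "G = \<lparr>pverts = V, parcs = qBMG_arcs a b c d ! i\<rparr>"
      using G by (rule P4_two_qBMGs_cases)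
    \<comment> \<open>Both labellings enumerate \<open>V\<close>, so the index is kept and only the
      vertices are renamed.\<close>
    then have "digraph_isomorphic G (Gs ! i)"
      using qBMG_arcs_isomorphic[OF abcd(1) assms(1) _ i] Gs[OF i] abcd(2) V_def by simp
    with i show ?thesis by blast
  qed
  have "equiv (P4_two_qBMGs V) R"
    unfolding R_def
    by (rule equivI) (auto simp: refl_on_def sym_def trans_def digraph_isomorphic_refl
      intro: digraph_isomorphic_sym digraph_isomorphic_trans)
  then have "card (P4_two_qBMGs V // R) = 4"
  proof (rule card_quotient_representatives)
    show "Gs ! i \<in> P4_two_qBMGs V" if "i < 4" for i
      using mem that .
    show "(Gs ! i, Gs ! j) \<notin> R" if "i < 4" "j < 4" "i \<noteq> j" for i j
      using noniso[OF that] by (simp add: R_def)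
    show "\<exists>i<4. (G, Gs ! i) \<in> R" if "G \<in> P4_two_qBMGs V" for G
      using iso[OF that] that mem unfolding R_def by blast
  qed
  with mem noniso iso show ?thesis by blast
qed

end
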